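(* Let $n,k$ be integers with $1\le k\le n-1$. The Johnson graph $J(n,k)$ is periodic if and only if it is isomorphic to one of $J(2,1)$, $J(3,1)$, $J(4,2)$; equivalently, if and only if $(n,k)\in\{(2,1),(3,1),(3,2),(4,2)\}$.
   Context: The Johnson graph $J(n,k)$ has as vertices the $k$-element subsets of an $n$-element set, two vertices $x,y$ being adjacent iff $|x\cap y|=k-1$. For a finite simple graph $G=(V,E)$, let $\mathcal{A}(G)=\{(u,v),(v,u) : uv\in E\}$ be its set of symmetric arcs; for an arc $e=(u,v)$ write $o(e)=u$, $t(e)=v$, $e^{-1}=(v,u)$. The Grover transfer matrix $U=U(G)$ is indexed by $\mathcal{A}(G)$ with $U_{e,f}=2/\deg(t(f))$ if $t(f)=o(e)$ and $e\neq f^{-1}$; $U_{e,f}=2/\deg(t(f))-1$ if $e=f^{-1}$; $U_{e,f}=0$ otherwise. $G$ is periodic if $U^k=I$ for some positive integer $k$. *)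

theory Defs
  imports
    "HOL.Real"
    "Graph_Theory.Pair_Digraph"
    "Graph_Theory.Digraph_Isomorphism"
    "Jordan_Normal_Form.Matrix"
begin

text \<open>
  A finite simple graph is a \<^locale>\<open>pair_graph\<close>: a finite, loop-free, symmetric set of ordered
  pairs.  Its set of pairs \<^const>\<open>parcs\<close> is the set of symmetric arcs; for an arc \<open>e\<close> the origin,
  the terminus and the inverse arc are \<open>fst e\<close>, \<open>snd e\<close> and \<open>prod.swap e\<close>.
\<close>

text \<open>
  The condition \<open>card (x \<inter> y) + 1 = k\<close> avoids the truncated \<open>k - 1\<close>, which would put a loop
  on the single vertex of \<open>J(n,0)\<close>.
\<close>

definition johnson_graph :: "nat \<Rightarrow> nat \<Rightarrow> nat set pair_pre_digraph" where
  "johnson_graph n k =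
    \<lparr> pverts = {x. x \<subseteq> {1..n} \<and> card x = k},
      parcs = {(x, y). x \<subseteq> {1..n} \<and> card x = k \<and> y \<subseteq> {1..n} \<and> card y = k
                \<and> card (x \<inter> y) + 1 = k} \<rparr>"

lemma pair_graph_johnson_graph: "pair_graph (johnson_graph n k)"
proof -
  let ?G = "johnson_graph n k"
  have verts: "pverts ?G \<subseteq> Pow {1..n}"
    unfolding johnson_graph_def by auto
  have arcs: "parcs ?G \<subseteq> pverts ?G \<times> pverts ?G"
    unfolding johnson_graph_def by auto
  have fin: "finite (pverts ?G)"
    by (rule finite_subset[OF verts]) simp
  have rev: "(y, x) \<in> parcs ?G" if "(x, y) \<in> parcs ?G" for x y
    using that unfolding johnson_graph_def by (simp add: Int_commute)
  have loop: "(x, x) \<notin> parcs ?G" for x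
    unfolding johnson_graph_def by simp
  show ?thesis
  proof
    show "finite (pverts ?G)" by (rule fin)
    show "finite (parcs ?G)"
      by (rule finite_subset[OF arcs]) (simp add: fin)
    show "symmetric (with_proj ?G)"
      unfolding symmetric_conv
    proof
      fix e assume "e \<in> arcs (with_proj ?G)"
      then have "(snd e, fst e) \<in> parcs ?G" using rev[of "fst e" "snd e"] by simp
      then show "\<exists>e2\<in>arcs (with_proj ?G). tail (with_proj ?G) e = head (with_proj ?G) e2
          \<and> head (with_proj ?G) e = tail (with_proj ?G) e2"
        by (intro bexI[of _ "(snd e, fst e)"]) simp_all
    qed
    fix e assume e: "e \<in> parcs ?G"
    then show "fst e \<in> pverts ?G" "snd e \<in> pverts ?G"
      using arcs by (auto simp: mem_Times_iff)
    show "fst e \<noteq> snd e"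
      using e loop by (metis prod.collapse)
  qed
qed

text \<open>
  In a symmetric digraph without multiple arcs the out-degree of a vertex is its degree in the
  underlying undirected graph.
\<close>

definition grover_entry :: "'a pair_pre_digraph \<Rightarrow> 'a \<times> 'a \<Rightarrow> 'a \<times> 'a \<Rightarrow> real" where
  "grover_entry G e f =
    (if snd f = fst e \<and> e \<noteq> prod.swap f then 2 / real (out_degree G (snd f))
     else if e = prod.swap f then 2 / real (out_degree G (snd f)) - 1
     else 0)"

text \<open>
  Matrices have index set \<open>{0..<m}\<close>, so the arcs are enumerated in an arbitrary but fixed order;
  another order conjugates the matrix by a permutation matrix.
\<close>

definition arc_list :: "'a pair_pre_digraph \<Rightarrow> ('a \<times> 'a) list" where
  "arc_list G = (SOME es. set es = parcs G \<and> distinct es)"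

definition grover_matrix :: "'a pair_pre_digraph \<Rightarrow> real mat" where
  "grover_matrix G =
    mat (card (parcs G)) (card (parcs G))
      (\<lambda>(i, j). grover_entry G (arc_list G ! i) (arc_list G ! j))"

definition periodic :: "'a pair_pre_digraph \<Rightarrow> bool" where
  "periodic G \<longleftrightarrow> (\<exists>m>0. grover_matrix G ^\<^sub>m m = 1\<^sub>m (card (parcs G)))"

end

theory Submission
  imports Defs
begin

text \<open>
  On functions on the arcs of a \<open>d\<close>-regular graph the Grover matrix acts by
  \<open>\<phi>(u, v) \<mapsto> (2/d) (\<Sum>w. \<phi>(w, u)) - \<phi>(v, u)\<close>.  An eigenfunction \<open>f\<close> of the adjacency operator with
  eigenvalue \<open>l\<close> gives the invariant span of \<open>g = f \<circ> fst\<close> and \<open>h = f \<circ> snd\<close>, on which \<open>h \<mapsto> g\<close> and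
  \<open>g \<mapsto> (2 l/d) g - h\<close>.  If a power of this map is the identity and \<open>2 l/d\<close> is rational, then
  \<open>2 l/d\<close> is a root of a monic integer polynomial, hence an integer.  For \<open>k \<le> n - k\<close> the least
  eigenvalue of \<open>J(n,k)\<close> is \<open>- k\<close> and the degree is \<open>k (n - k)\<close>, so \<open>2/(n - k)\<close> is an integer and
  \<open>n - k \<le> 2\<close>; complementation of sets reduces the other case to this one.

  Conversely, the in-sums \<open>a\<^sub>t(v)\<close> of the \<open>t\<close>-th iterate satisfy
  \<open>a\<^sub>t\<^sub>+\<^sub>2 = (2/d) A a\<^sub>t\<^sub>+\<^sub>1 - a\<^sub>t\<close> with \<open>A\<close> the adjacency operator, and they determine the increments
  of \<open>\<phi>\<close> over two steps; in the small cases these increments add up to zero over a period.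
\<close>

section \<open>Periodicity in terms of arc functions\<close>

definition neighbours :: "'a pair_pre_digraph \<Rightarrow> 'a \<Rightarrow> 'a set" where
  "neighbours G v = {u. (v, u) \<in> parcs G}"

definition grover_op :: "'a pair_pre_digraph \<Rightarrow> ('a \<times> 'a \<Rightarrow> real) \<Rightarrow> 'a \<times> 'a \<Rightarrow> real" where
  "grover_op G \<phi> e = (\<Sum>f\<in>parcs G. grover_entry G e f * \<phi> f)"

lemma arc_list_enumerates:
  assumes "finite (parcs G)"
  shows "set (arc_list G) = parcs G" "distinct (arc_list G)" "length (arc_list G) = card (parcs G)"
proof -
  have "set (arc_list G) = parcs G \<and> distinct (arc_list G)"
    unfolding arc_list_def using finite_distinct_list[OF assms] by (rule someI_ex)
  then show "set (arc_list G) = parcs G" "distinct (arc_list G)"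
      "length (arc_list G) = card (parcs G)"
    by (auto dest: distinct_card)
qed

text \<open>Matrix powers split off a factor on the right, so M^(m+1) v = M^m (M v). The induction
  therefore has to range over all arc functions: its hypothesis is applied to
  \<open>grover_op G \<phi>\<close>.\<close>

lemma grover_matrix_pow_mult_vec:
  assumes "finite (parcs G)"
  shows "grover_matrix G ^\<^sub>m m *\<^sub>v vec (card (parcs G)) (\<lambda>i. \<phi> (arc_list G ! i)) =
    vec (card (parcs G)) (\<lambda>i. (grover_op G ^^ m) \<phi> (arc_list G ! i))"
proof (induction m arbitrary: \<phi>)
  case 0
  show ?case by (simp add: grover_matrix_def)
next
  case (Suc m)
  let ?N = "card (parcs G)" and ?M = "grover_matrix G" and ?es = "arc_list G"
  note es = arc_list_enumerates[OF assms]
  have M: "?M \<in> carrier_mat ?N ?N"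
    by (simp add: grover_matrix_def)
  have "?M *\<^sub>v vec ?N (\<lambda>i. \<phi> (?es ! i)) = vec ?N (\<lambda>i. grover_op G \<phi> (?es ! i))"
  proof (rule eq_vecI)
    fix i assume "i < dim_vec (vec ?N (\<lambda>i. grover_op G \<phi> (?es ! i)))"
    then have i: "i < ?N" by simp
    have "(?M *\<^sub>v vec ?N (\<lambda>i. \<phi> (?es ! i))) $ i =
        (\<Sum>j<?N. grover_entry G (?es ! i) (?es ! j) * \<phi> (?es ! j))"
      using i by (simp add: grover_matrix_def scalar_prod_def lessThan_atLeast0)
    also have "\<dots> = grover_op G \<phi> (?es ! i)"
      unfolding grover_op_def using es
      by (intro sum.reindex_bij_betw[OF bij_betw_nth]) auto
    finally show "(?M *\<^sub>v vec ?N (\<lambda>i. \<phi> (?es ! i))) $ i = vec ?N (\<lambda>i. grover_op G \<phi> (?es ! i)) $ i"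
      using i by simp
  qed (simp add: grover_matrix_def)
  then show ?case
    using Suc.IH[of "grover_op G \<phi>"] M pow_carrier_mat[OF M, of m]
    by (simp add: assoc_mult_mat_vec[of _ ?N ?N _ ?N] funpow_swap1)
qed

lemma index_mult_unit_vec:
  fixes A :: "'a :: semiring_1 mat"
  assumes "A \<in> carrier_mat n m" and "i < n" and "j < m"
  shows "(A *\<^sub>v unit_vec m j) $ i = A $$ (i, j)"
  using assms by simp

lemma periodic_iff_grover_op:
  assumes fin: "finite (parcs G)"
  shows "periodic G \<longleftrightarrow> (\<exists>m>0. \<forall>\<phi>. \<forall>e\<in>parcs G. (grover_op G ^^ m) \<phi> e = \<phi> e)"
proof -
  let ?N = "card (parcs G)" and ?M = "grover_matrix G" and ?es = "arc_list G"
  note es = arc_list_enumerates[OF fin]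
  have "?M ^\<^sub>m m = 1\<^sub>m ?N \<longleftrightarrow> (\<forall>\<phi>. \<forall>e\<in>parcs G. (grover_op G ^^ m) \<phi> e = \<phi> e)" for m
  proof
    assume M1: "?M ^\<^sub>m m = 1\<^sub>m ?N"
    show "\<forall>\<phi>. \<forall>e\<in>parcs G. (grover_op G ^^ m) \<phi> e = \<phi> e"
    proof (intro allI ballI)
      fix \<phi> e assume "e \<in> parcs G"
      then obtain i where i: "i < ?N" "e = ?es ! i"
        using es by (metis in_set_conv_nth)
      have "vec ?N (\<lambda>i. \<phi> (?es ! i)) = vec ?N (\<lambda>i. (grover_op G ^^ m) \<phi> (?es ! i))"
        using grover_matrix_pow_mult_vec[OF fin, of m \<phi>] by (simp add: M1)
      then have "vec ?N (\<lambda>i. \<phi> (?es ! i)) $ i = vec ?N (\<lambda>i. (grover_op G ^^ m) \<phi> (?es ! i)) $ i"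
        by simp
      then show "(grover_op G ^^ m) \<phi> e = \<phi> e"
        using i by simp
    qed
  next
    assume op: "\<forall>\<phi>. \<forall>e\<in>parcs G. (grover_op G ^^ m) \<phi> e = \<phi> e"
    have M: "?M ^\<^sub>m m \<in> carrier_mat ?N ?N"
      by (rule pow_carrier_mat) (simp add: grover_matrix_def)
    show "?M ^\<^sub>m m = 1\<^sub>m ?N"
    proof (rule eq_matI)
      fix i j assume "i < dim_row (1\<^sub>m ?N :: real mat)" "j < dim_col (1\<^sub>m ?N :: real mat)"
      then have ij: "i < ?N" "j < ?N" by simp_all
      \<comment> \<open>The indicator of the \<open>j\<close>-th arc reads off column
        \<open>j\<close> of the matrix power.\<close>
      let ?\<phi> = "\<lambda>e. if e = ?es ! j then 1 else 0 :: real"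
      have unit: "vec ?N (\<lambda>i. ?\<phi> (?es ! i)) = unit_vec ?N j"
        using ij es by (intro eq_vecI) (auto simp: nth_eq_iff_index_eq)
      have "(?M ^\<^sub>m m) $$ (i, j) = (?M ^\<^sub>m m *\<^sub>v unit_vec ?N j) $ i"
        by (rule index_mult_unit_vec[symmetric, OF M ij])
      also have "\<dots> = (grover_op G ^^ m) ?\<phi> (?es ! i)"
        using ij grover_matrix_pow_mult_vec[OF fin, of m ?\<phi>] unfolding unit by simp
      also have "\<dots> = ?\<phi> (?es ! i)"
      proof (rule op[rule_format])
        show "?es ! i \<in> parcs G" using es ij nth_mem[of i ?es] by simp
      qed
      also have "\<dots> = 1\<^sub>m ?N $$ (i, j)"
        using ij es by (simp add: nth_eq_iff_index_eq)
      finally show "(?M ^\<^sub>m m) $$ (i, j) = 1\<^sub>m ?N $$ (i, j)" .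
    qed (use M in auto)
  qed
  then show ?thesis
    unfolding periodic_def by simp
qed

lemma grover_op_cong:
  assumes "\<And>f. f \<in> parcs G \<Longrightarrow> \<phi> f = \<psi> f"
  shows "grover_op G \<phi> e = grover_op G \<psi> e"
  unfolding grover_op_def using assms by simp

text \<open>An entry depends only on incidences and degrees, which an isomorphism preserves. Hence
  pulling back along \<open>iso_arcs h\<close> intertwines the two Grover operators and all their
  powers.\<close>

lemma periodic_digraph_iso:
  assumes iso: "digraph_iso (with_proj G) (with_proj H)" and fin: "finite (parcs G)"
    and per: "periodic G"
  shows "periodic H"
proof -
  obtain h where h: "pre_digraph.digraph_isomorphism (with_proj G) h"
    and H: "with_proj H = app_iso h (with_proj G)"
    using iso unfolding digraph_iso_def by blast
  interpret wf_digraph "with_proj G"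
    using h by (simp add: pre_digraph.digraph_isomorphism_def)
  let ?\<alpha> = "iso_arcs h" and ?\<beta> = "iso_verts h"
  have arcs: "parcs H = ?\<alpha> ` parcs G"
    by (metis H arcs_app_iso with_proj_simps(2))
  \<comment> \<open>\<open>app_iso\<close> takes its tail and head maps from \<open>h\<close>; since
    the image is \<open>with_proj H\<close>, they must be the projections.\<close>
  have tail: "iso_tail h = fst" and head: "iso_head h = snd"
    by (metis H tail_app_iso with_proj_simps(4), metis H head_app_iso with_proj_simps(5))
  have ends: "fst (?\<alpha> e) = ?\<beta> (fst e)" "snd (?\<alpha> e) = ?\<beta> (snd e)" if "e \<in> parcs G" for e
    using iso_verts_tail[OF h] iso_verts_head[OF h] that tail head by simp_all
  have verts: "fst e \<in> pverts G" "snd e \<in> pverts G" if "e \<in> parcs G" for e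
    using that wellformed by simp_all
  have inj: "?\<beta> u = ?\<beta> v \<longleftrightarrow> u = v" if "u \<in> pverts G" "v \<in> pverts G" for u v
    using iso_verts_eq_iff[OF h] that by simp
  have deg: "out_degree (with_proj H) (?\<beta> u) = out_degree (with_proj G) u" if "u \<in> pverts G" for u
    using out_degree_app_iso_eq[OF h] that unfolding H by simp
  have entry: "grover_entry H (?\<alpha> e) (?\<alpha> f) = grover_entry G e f"
    if "e \<in> parcs G" "f \<in> parcs G" for e f
    unfolding grover_entry_def
    using that by (simp add: prod_eq_iff ends verts inj deg)
  have inj_arcs: "inj_on ?\<alpha> (parcs G)"
    using digraph_isomorphism_inj_on_arcs[OF h] by simp
  have step: "grover_op H \<phi> (?\<alpha> e) = grover_op G (\<lambda>f. \<phi> (?\<alpha> f)) e" if "e \<in> parcs G" for \<phi> e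
    unfolding grover_op_def arcs
    using that by (simp add: sum.reindex[OF inj_arcs] entry)
  have pow: "(grover_op H ^^ m) \<phi> (?\<alpha> e) = (grover_op G ^^ m) (\<lambda>f. \<phi> (?\<alpha> f)) e"
    if "e \<in> parcs G" for m \<phi> e
    using that
  proof (induction m arbitrary: e)
    case (Suc m)
    have "(grover_op H ^^ Suc m) \<phi> (?\<alpha> e) = grover_op G (\<lambda>f. (grover_op H ^^ m) \<phi> (?\<alpha> f)) e"
      using step[OF Suc.prems] by simp
    also have "\<dots> = grover_op G ((grover_op G ^^ m) (\<lambda>f. \<phi> (?\<alpha> f))) e"
      by (rule grover_op_cong) (rule Suc.IH)
    finally show ?case by simp
  qed simp
  have finH: "finite (parcs H)"
    unfolding arcs using fin by (rule finite_imageI)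
  obtain m where m: "m > 0" "\<And>\<phi> e. e \<in> parcs G \<Longrightarrow> (grover_op G ^^ m) \<phi> e = \<phi> e"
    using per unfolding periodic_iff_grover_op[OF fin] by blast
  have "(grover_op H ^^ m) \<phi> e = \<phi> e" if e: "e \<in> parcs H" for \<phi> e
  proof -
    obtain f where f: "f \<in> parcs G" "e = ?\<alpha> f"
      using e unfolding arcs by blast
    show ?thesis
      unfolding f(2) pow[OF f(1)] m(2)[OF f(1)] by simp
  qed
  then show ?thesis
    unfolding periodic_iff_grover_op[OF finH] using m(1) by blast
qed

section \<open>Regular graphs\<close>

lemma (in pair_graph) grover_op_eq:
  assumes "(u, v) \<in> parcs G"
  shows "grover_op G \<phi> (u, v) =
    2 / real (out_degree G u) * (\<Sum>w\<in>neighbours G u. \<phi> (w, u)) - \<phi> (v, u)"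
proof -
  have rev: "(v, u) \<in> parcs G"
    using assms arcs_symmetric by blast
  let ?c = "2 / real (out_degree G u)"
  \<comment> \<open>The inverse arc \<open>(v, u)\<close> also ends in \<open>u\<close>. So the two
    nonzero cases merge: weight \<open>?c\<close> on every arc ending in \<open>u\<close>, with the
    correction -1 at \<open>(v, u)\<close>.\<close>
  have "grover_op G \<phi> (u, v) =
      (\<Sum>f\<in>parcs G. (if snd f = u then ?c * \<phi> f else 0) - (if f = (v, u) then \<phi> f else 0))"
    unfolding grover_op_def
    by (intro sum.cong) (auto simp: grover_entry_def algebra_simps)
  also have "\<dots> = (\<Sum>f\<in>parcs G. if snd f = u then ?c * \<phi> f else 0)
      - (\<Sum>f\<in>parcs G. if f = (v, u) then \<phi> f else 0)"
    by (rule sum_subtractf)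
  also have "(\<Sum>f\<in>parcs G. if f = (v, u) then \<phi> f else 0) = \<phi> (v, u)"
    unfolding sum.delta[OF pair_finite_arcs] using rev by simp
  also have "(\<Sum>f\<in>parcs G. if snd f = u then ?c * \<phi> f else 0) =
      (\<Sum>f\<in>{f \<in> parcs G. snd f = u}. ?c * \<phi> f)"
    by (rule sum.inter_filter[OF pair_finite_arcs, symmetric])
  also have "(\<Sum>f\<in>{f \<in> parcs G. snd f = u}. ?c * \<phi> f) = (\<Sum>w\<in>neighbours G u. ?c * \<phi> (w, u))"
    by (rule sum.reindex_bij_witness[where i="\<lambda>w. (w, u)" and j=fst])
      (auto simp: neighbours_def intro: arcs_symmetric)
  finally show ?thesis
    by (simp add: sum_distrib_left)
qed

lemma out_degree_eq_card_neighbours: "out_degree (with_proj G) v = card (neighbours G v)"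
proof -
  have "out_arcs (with_proj G) v = Pair v ` neighbours G v"
    by (auto simp: neighbours_def)
  then show ?thesis
    by (simp add: out_degree_def card_image inj_on_def)
qed

context pair_graph
begin

lemma finite_neighbours: "finite (neighbours G v)"
  by (rule finite_subset[OF _ pair_finite_verts]) (auto simp: neighbours_def dest: in_arcsD2)

lemma grover_op_regular:
  assumes reg: "\<And>v. v \<in> pverts G \<Longrightarrow> card (neighbours G v) = d" and e: "(u, v) \<in> parcs G"
  shows "grover_op G \<phi> (u, v) = 2 / real d * (\<Sum>w\<in>neighbours G u. \<phi> (w, u)) - \<phi> (v, u)"
  using grover_op_eq[OF e] reg[OF in_arcsD1[OF e]] by (simp add: out_degree_eq_card_neighbours)

text \<open>At the arc \<open>(u, v)\<close> only the coordinate along \<open>f o fst\<close> is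
  visible, because \<open>f v = 0\<close>. After a full period the orbit of \<open>f o snd\<close>
  has the value \<open>f v = 0\<close> there again, so \<open>f u \<noteq> 0\<close> forces this
  coordinate to vanish, and \<open>r\<close> divides a power of the coprime
  \<open>p\<close>.\<close>

lemma is_unit_denominator_of_periodic:
  fixes p r :: int
  assumes reg: "\<And>v. v \<in> pverts G \<Longrightarrow> card (neighbours G v) = d"
    and eigen: "\<And>v. v \<in> pverts G \<Longrightarrow> (\<Sum>w\<in>neighbours G v. f w) = l * f v"
    and ratio: "2 * l / real d = of_int p / of_int r" and "coprime p r" and "r \<noteq> 0"
    and arc: "(u, v) \<in> parcs G" and "f u \<noteq> 0" and "f v = 0" and per: "periodic G"
  shows "is_unit r"
proof -
  let ?g = "\<lambda>e. f (fst e)" and ?h = "\<lambda>e. f (snd e)"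
  have card0: "d \<noteq> 0"
  proof -
    have "v \<in> neighbours G u" using arc by (simp add: neighbours_def)
    then show ?thesis
      using reg[OF in_arcsD1[OF arc]] finite_neighbours[of u] by (auto simp: card_gt_0_iff)
  qed
  \<comment> \<open>With this choice of sign the new coefficient of \<open>?h\<close> is the old
    coefficient of \<open>?g\<close>, so the coefficients follow a second-order recurrence.\<close>
  have step: "grover_op G (\<lambda>e. x * ?g e - y * ?h e) e =
      (x * of_int p / of_int r - y) * ?g e - x * ?h e" if e': "e \<in> parcs G" for x y e
  proof -
    obtain a b where e: "e = (a, b)" "(a, b) \<in> parcs G" using e' by (cases e) auto
    have a: "a \<in> pverts G" using in_arcsD1[OF e(2)] .
    have "grover_op G (\<lambda>e. x * ?g e - y * ?h e) e =
        2 / real d * (x * (l * f a) - y * (real d * f a)) - (x * f b - y * f a)"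
      using grover_op_regular[OF reg e(2), of "\<lambda>e. x * ?g e - y * ?h e"] eigen[OF a] reg[OF a]
      by (simp add: e(1) sum_subtractf flip: sum_distrib_left)
    also have "\<dots> = (x * (2 * l / real d) - y) * f a - x * f b"
      using card0 by (simp add: field_simps)
    finally show ?thesis by (simp add: ratio e(1))
  qed
  \<comment> \<open>Scaling by powers of \<open>r\<close> keeps the coordinates of the orbit of \<open>?h\<close> integral, and the leading
    one is \<open>p ^ m\<close> modulo \<open>r\<close>; it can only vanish if \<open>r\<close> is a unit.\<close>
  have "\<exists>x y :: int. r dvd x - p ^ m \<and> (\<forall>e\<in>parcs G. of_int r ^ m * (grover_op G ^^ Suc m) ?h e =
      of_int x * ?g e - of_int r * of_int y * ?h e)" for m
  proof (induction m)
    case 0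
    \<comment> \<open>The first step costs no denominator; hence the scaling \<open>r ^ m\<close>
      for \<open>Suc m\<close> iterations.\<close>
    have "grover_op G ?h e = ?g e" if "e \<in> parcs G" for e
      using step[OF that, of 0 "-1"] by simp
    then show ?case by (intro exI[of _ 1] exI[of _ 0]) simp
  next
    case (Suc m)
    then obtain x y :: int where dvd: "r dvd x - p ^ m"
      and xy: "\<And>e. e \<in> parcs G \<Longrightarrow> of_int r ^ m * (grover_op G ^^ Suc m) ?h e =
        of_int x * ?g e - of_int r * of_int y * ?h e" by blast
    have "of_int r ^ Suc m * (grover_op G ^^ Suc (Suc m)) ?h e =
        of_int (x * p - r * r * y) * ?g e - of_int r * of_int x * ?h e" if e: "e \<in> parcs G" for e
    proof -
      have "of_int r ^ m * (grover_op G ^^ Suc (Suc m)) ?h e =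
          grover_op G (\<lambda>e. of_int r ^ m * (grover_op G ^^ Suc m) ?h e) e"
        by (simp add: grover_op_def[of G _ e] sum_distrib_left mult.left_commute)
      also have "\<dots> = grover_op G (\<lambda>e. of_int x * ?g e - of_int r * of_int y * ?h e) e"
        by (rule grover_op_cong) (rule xy)
      also have "\<dots> = (of_int x * of_int p / of_int r - of_int r * of_int y) * ?g e - of_int x * ?h e"
        by (rule step[OF e])
      finally have "of_int r ^ Suc m * (grover_op G ^^ Suc (Suc m)) ?h e = of_int r *
          ((of_int x * of_int p / of_int r - of_int r * of_int y) * ?g e - of_int x * ?h e)"
        by (simp only: power_Suc mult.assoc)
      also have "\<dots> = of_int (x * p - r * r * y) * ?g e - of_int r * of_int x * ?h e"
        using \<open>r \<noteq> 0\<close> by (simp add: field_simps)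
      finally show ?thesis .
    qed
    moreover have "r dvd x * p - r * r * y - p ^ Suc m"
    proof -
      have "x * p - r * r * y - p ^ Suc m = (x - p ^ m) * p - r * (r * y)"
        by (simp add: algebra_simps)
      then show ?thesis using dvd by (metis dvd_diff dvd_mult2 dvd_triv_left)
    qed
    ultimately show ?case by blast
  qed
  note orbit = this
  obtain M where M: "M > 0" "\<And>\<phi> e. e \<in> parcs G \<Longrightarrow> (grover_op G ^^ M) \<phi> e = \<phi> e"
    using per unfolding periodic_iff_grover_op[OF pair_finite_arcs] by blast
  then obtain m where m: "M = Suc m" by (cases M) auto
  obtain x y :: int where dvd: "r dvd x - p ^ m"
    and "\<forall>e\<in>parcs G. of_int r ^ m * (grover_op G ^^ Suc m) ?h e =
        of_int x * ?g e - of_int r * of_int y * ?h e"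
    using orbit by blast
  then have "of_int r ^ m * (grover_op G ^^ Suc m) ?h (u, v) =
      of_int x * ?g (u, v) - of_int r * of_int y * ?h (u, v)"
    using arc by blast
  then have "x = 0"
    using M(2)[OF arc, of ?h] \<open>f u \<noteq> 0\<close> \<open>f v = 0\<close> unfolding m by simp
  then have "r dvd p ^ m"
    using dvd by simp
  moreover have "coprime (p ^ m) r"
    using \<open>coprime p r\<close> by simp
  ultimately show ?thesis
    by (metis coprime_common_divisor dvd_refl)
qed

section \<open>Vertex sums of arc functions and their recurrence\<close>

definition in_sum :: "('a \<times> 'a \<Rightarrow> real) \<Rightarrow> 'a \<Rightarrow> real" where
  "in_sum \<phi> v = (\<Sum>w\<in>neighbours G v. \<phi> (w, v))"

definition out_sum :: "('a \<times> 'a \<Rightarrow> real) \<Rightarrow> 'a \<Rightarrow> real" where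
  "out_sum \<phi> v = (\<Sum>w\<in>neighbours G v. \<phi> (v, w))"

text \<open>Both sides count every arc exactly once, grouped by its terminus or by its
  origin.\<close>

lemma sum_in_sum_eq_sum_out_sum: "(\<Sum>v\<in>pverts G. in_sum \<phi> v) = (\<Sum>v\<in>pverts G. out_sum \<phi> v)"
proof -
  have "(\<Sum>v\<in>pverts G. in_sum \<phi> v) = (\<Sum>(v, w)\<in>Sigma (pverts G) (neighbours G). \<phi> (w, v))"
    unfolding in_sum_def by (rule sum.Sigma) (auto simp: finite_neighbours)
  also have "\<dots> = (\<Sum>(v, w)\<in>Sigma (pverts G) (neighbours G). \<phi> (v, w))"
    by (rule sum.reindex_bij_witness[where i=prod.swap and j=prod.swap])
      (auto simp: neighbours_def intro: arcs_symmetric in_arcsD2)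
  also have "\<dots> = (\<Sum>v\<in>pverts G. out_sum \<phi> v)"
    unfolding out_sum_def by (rule sum.Sigma[symmetric]) (auto simp: finite_neighbours)
  finally show ?thesis .
qed

context
  fixes d :: nat
  assumes reg: "\<And>v. v \<in> pverts G \<Longrightarrow> card (neighbours G v) = d" and d: "d > 0"
begin

text \<open>Each of the \<open>d\<close> arcs leaving \<open>v\<close> receives 2/d of the in-sum,
  together twice the in-sum, and the reflected values take one copy away. This lets out-sums be
  eliminated in favour of the in-sums one step earlier.\<close>

lemma out_sum_grover_op:
  assumes "v \<in> pverts G"
  shows "out_sum (grover_op G \<phi>) v = in_sum \<phi> v"
proof -
  have "out_sum (grover_op G \<phi>) v =
      (\<Sum>w\<in>neighbours G v. 2 / real d * in_sum \<phi> v - \<phi> (w, v))"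
    unfolding out_sum_def
    by (rule sum.cong) (simp_all add: neighbours_def in_sum_def grover_op_regular[OF reg])
  also have "\<dots> = in_sum \<phi> v"
    using reg[OF assms] d by (simp add: sum_subtractf) (simp add: in_sum_def)
  finally show ?thesis .
qed

lemma in_sum_grover_op:
  "in_sum (grover_op G \<phi>) v = 2 / real d * (\<Sum>w\<in>neighbours G v. in_sum \<phi> w) - out_sum \<phi> v"
proof -
  have "in_sum (grover_op G \<phi>) v =
      (\<Sum>w\<in>neighbours G v. 2 / real d * in_sum \<phi> w - \<phi> (v, w))"
    unfolding in_sum_def[of "grover_op G \<phi>"]
    by (rule sum.cong)
      (simp_all add: neighbours_def in_sum_def grover_op_regular[OF reg] arcs_symmetric)
  then show ?thesis
    by (simp add: sum_subtractf out_sum_def sum_distrib_left)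
qed

text \<open>The conserved total is the constant \<open>s\<close> of the small cases: there a vertex
  is adjacent to all but one or two vertices, so a sum over neighbours is \<open>s\<close> minus one
  or two terms.\<close>

lemma sum_in_sum_grover_op_pow:
  "(\<Sum>v\<in>pverts G. in_sum ((grover_op G ^^ m) \<phi>) v) = (\<Sum>v\<in>pverts G. in_sum \<phi> v)"
proof (induction m)
  case (Suc m)
  have "(\<Sum>v\<in>pverts G. in_sum ((grover_op G ^^ Suc m) \<phi>) v) =
      (\<Sum>v\<in>pverts G. out_sum (grover_op G ((grover_op G ^^ m) \<phi>)) v)"
    by (simp add: sum_in_sum_eq_sum_out_sum)
  also have "\<dots> = (\<Sum>v\<in>pverts G. in_sum ((grover_op G ^^ m) \<phi>) v)"
    by (simp add: out_sum_grover_op)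
  finally show ?case using Suc.IH by simp
qed simp

lemma in_sum_grover_op_pow_rec:
  assumes "v \<in> pverts G"
  shows "in_sum ((grover_op G ^^ Suc (Suc m)) \<phi>) v =
    2 / real d * (\<Sum>w\<in>neighbours G v. in_sum ((grover_op G ^^ Suc m) \<phi>) w)
      - in_sum ((grover_op G ^^ m) \<phi>) v"
  using in_sum_grover_op[of "(grover_op G ^^ Suc m) \<phi>" v]
    out_sum_grover_op[OF assms, of "(grover_op G ^^ m) \<phi>"] by simp

text \<open>One step passes to the reversed arc with a minus sign, so two steps come back to the
  same arc with a plus sign and only in-sums are added.\<close>

lemma grover_op_pow_rec:
  assumes e: "(u, v) \<in> parcs G"
  shows "(grover_op G ^^ Suc (Suc m)) \<phi> (u, v) = (grover_op G ^^ m) \<phi> (u, v) +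
    2 / real d * (in_sum ((grover_op G ^^ Suc m) \<phi>) u - in_sum ((grover_op G ^^ m) \<phi>) v)"
  using e arcs_symmetric[OF e]
  by (simp add: grover_op_regular[OF reg] in_sum_def algebra_simps)

end

end

section \<open>Johnson graphs\<close>

lemma pverts_johnson_graph: "pverts (johnson_graph n k) = {x. x \<subseteq> {1..n} \<and> card x = k}"
  by (simp add: johnson_graph_def)

text \<open>A neighbour \<open>y\<close> exchanges one element of \<open>x\<close> for one outside;
  the pair is recovered from the singletons \<open>x - y\<close> and \<open>y - x\<close>. This
  turns sums over neighbours into double sums.\<close>

lemma bij_betw_neighbours_johnson_graph:
  assumes x: "x \<in> pverts (johnson_graph n k)"
  shows "bij_betw (\<lambda>(a, b). insert b (x - {a})) (x \<times> ({1..n} - x)) (neighbours (johnson_graph n k) x)"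
proof (rule bij_betwI')
  have xs: "x \<subseteq> {1..n}" "card x = k" "finite x"
    using x by (auto simp: pverts_johnson_graph intro: finite_subset)
  fix p assume p: "p \<in> x \<times> ({1..n} - x)"
  show "((case p of (a, b) \<Rightarrow> insert b (x - {a})) = (case q of (a, b) \<Rightarrow> insert b (x - {a}))) = (p = q)"
    if q: "q \<in> x \<times> ({1..n} - x)" for q
  proof
    obtain a b c e where pq: "p = (a, b)" "q = (c, e)" "a \<in> x" "c \<in> x" "b \<notin> x" "e \<notin> x"
      using p q by auto
    assume "(case p of (a, b) \<Rightarrow> insert b (x - {a})) = (case q of (a, b) \<Rightarrow> insert b (x - {a}))"
    then have eq: "insert b (x - {a}) = insert e (x - {c})"
      using pq by simp
    have "b \<in> insert e (x - {c})" "a \<notin> insert e (x - {c})"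
      unfolding eq[symmetric] using pq by auto
    then have "b = e" "a = c"
      using pq by auto
    then show "p = q" using pq by simp
  qed simp
  obtain a b where ab: "p = (a, b)" "a \<in> x" "b \<in> {1..n}" "b \<notin> x"
    using p by auto
  have "x \<inter> insert b (x - {a}) = x - {a}"
    using ab by auto
  moreover have "card (insert b (x - {a})) = k"
    using ab xs by (simp add: card.insert_remove card_Suc_Diff1 del: card_Diff_insert card_Diff_singleton)
  moreover have "card (x - {a}) + 1 = k"
    using ab xs by (metis Suc_eq_plus1 card_Suc_Diff1)
  ultimately show "(case p of (a, b) \<Rightarrow> insert b (x - {a})) \<in> neighbours (johnson_graph n k) x"
    using ab xs by (auto simp: neighbours_def johnson_graph_def)
next
  have xs: "x \<subseteq> {1..n}" "card x = k" "finite x"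
    using x by (auto simp: pverts_johnson_graph intro: finite_subset)
  fix y assume "y \<in> neighbours (johnson_graph n k) x"
  then have y: "y \<subseteq> {1..n}" "card y = k" "card (x \<inter> y) + 1 = k" "finite y"
    by (auto simp: neighbours_def johnson_graph_def intro: finite_subset)
  have "card (x - y) = 1" "card (y - x) = 1"
    using y xs card_Diff_subset_Int[of x y] card_Diff_subset_Int[of y x]
    by (simp_all add: Int_commute)
  then obtain a b where ab: "x - y = {a}" "y - x = {b}"
    by (metis card_1_singletonE)
  then have "y = insert b (x - {a})" "a \<in> x" "b \<in> {1..n} - x"
    using y(1) by auto
  then show "\<exists>p\<in>x \<times> ({1..n} - x). y = (case p of (a, b) \<Rightarrow> insert b (x - {a}))"
    by (intro bexI[of _ "(a, b)"]) auto
qed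

lemma card_neighbours_johnson_graph:
  assumes "x \<in> pverts (johnson_graph n k)"
  shows "card (neighbours (johnson_graph n k) x) = k * (n - k)"
proof -
  have "x \<subseteq> {1..n}" "card x = k"
    using assms by (auto simp: pverts_johnson_graph)
  then show ?thesis
    using bij_betw_same_card[OF bij_betw_neighbours_johnson_graph[OF assms]]
    by (simp add: card_cartesian_product card_Diff_subset finite_subset[of x "{1..n}"])
qed

lemma sum_neighbours_johnson_graph:
  assumes "x \<in> pverts (johnson_graph n k)"
  shows "(\<Sum>y\<in>neighbours (johnson_graph n k) x. f y) =
    (\<Sum>a\<in>x. \<Sum>b\<in>{1..n} - x. f (insert b (x - {a})))"
  unfolding sum.cartesian_product
  using sum.reindex_bij_betw[OF bij_betw_neighbours_johnson_graph[OF assms], of f]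
  by (simp add: case_prod_unfold)

text \<open>Adjacent \<open>k\<close>-sets have a union of size k + 1, so their complements meet in
  n - k - 1 elements.\<close>

lemma digraph_iso_johnson_graph_complement:
  assumes "k \<le> n"
  shows "digraph_iso (johnson_graph n k) (johnson_graph n (n - k))"
proof -
  let ?c = "\<lambda>x. {1..n} - x"
  let ?V = "pverts (johnson_graph n k)" and ?A = "parcs (johnson_graph n k)"
  let ?h = "\<lparr>iso_verts = ?c, iso_arcs = map_prod ?c ?c, iso_head = snd, iso_tail = fst\<rparr>"
  interpret pair_graph "johnson_graph n k"
    by (rule pair_graph_johnson_graph)
  have c_c: "?c (?c x) = x" if "x \<subseteq> {1..n}" for x
    using that by auto
  \<comment> \<open>Stated for any \<open>j\<close>: the case \<open>k\<close> shows that
    complementation maps into the target, the case \<open>n - k\<close> that it is onto.\<close>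
  have c_vert: "?c x \<in> pverts (johnson_graph n (n - j))" if "x \<in> pverts (johnson_graph n j)" for x j
    using that by (auto simp: pverts_johnson_graph card_Diff_subset finite_subset)
  have c_arc: "(?c x, ?c y) \<in> parcs (johnson_graph n (n - j))"
    if "(x, y) \<in> parcs (johnson_graph n j)" "j \<le> n" for x y j
  proof -
    have xy: "x \<subseteq> {1..n}" "y \<subseteq> {1..n}" "card x = j" "card y = j" "card (x \<inter> y) + 1 = j"
      using that by (auto simp: johnson_graph_def)
    then have fin: "finite x" "finite y" by (auto intro: finite_subset)
    have "card (x \<union> y) = j + 1"
      using card_Un_Int[OF fin] xy by simp
    moreover have "card (x \<union> y) \<le> n"
      using xy card_mono[of "{1..n}" "x \<union> y"] by simp
    moreover have "?c x \<inter> ?c y = {1..n} - (x \<union> y)" by auto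
    ultimately have "card (?c x \<inter> ?c y) + 1 = n - j"
      using xy fin by (simp add: card_Diff_subset)
    then show ?thesis
      using xy fin by (auto simp: johnson_graph_def card_Diff_subset)
  qed
  have "pre_digraph.digraph_isomorphism (johnson_graph n k) ?h"
    unfolding pre_digraph.digraph_isomorphism_def
  proof (intro conjI ballI)
    show "wf_digraph (johnson_graph n k)" by unfold_locales
    have inj: "inj_on ?c (Pow {1..n})"
      by (metis (no_types, lifting) PowD c_c inj_onI)
    show "inj_on (iso_verts ?h) (verts (johnson_graph n k))"
      using inj_on_subset[OF inj, of ?V] by (auto simp: pverts_johnson_graph)
    show "inj_on (iso_arcs ?h) (arcs (johnson_graph n k))"
      using inj_on_subset[OF map_prod_inj_on[OF inj inj], of ?A] by (auto simp: johnson_graph_def)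
  qed auto
  moreover have "with_proj (johnson_graph n (n - k)) = app_iso ?h (johnson_graph n k)"
  proof -
    have "pverts (johnson_graph n (n - k)) \<subseteq> ?c ` ?V"
    proof
      fix y assume y: "y \<in> pverts (johnson_graph n (n - k))"
      then have "?c y \<in> ?V" "y = ?c (?c y)"
        using c_vert[OF y] assms c_c[of y] by (auto simp: pverts_johnson_graph)
      then show "y \<in> ?c ` ?V" by blast
    qed
    moreover have "parcs (johnson_graph n (n - k)) \<subseteq> map_prod ?c ?c ` ?A"
    proof
      fix e assume e: "e \<in> parcs (johnson_graph n (n - k))"
      obtain x y where xy: "e = (x, y)" by (cases e)
      have "(?c x, ?c y) \<in> ?A"
        using c_arc[of x y "n - k"] e xy assms by simp
      moreover have "e = map_prod ?c ?c (?c x, ?c y)"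
        using e xy c_c[of x] c_c[of y] by (simp add: johnson_graph_def)
      ultimately show "e \<in> map_prod ?c ?c ` ?A" by blast
    qed
    ultimately show ?thesis
      using c_vert[of _ k] c_arc[of _ _ k] assms
      by (intro pre_digraph.equality) (auto simp: app_iso_def)
  qed
  ultimately show ?thesis
    unfolding digraph_iso_def by blast
qed

text \<open>An eigenfunction of the Johnson graph for its least eigenvalue \<open>- k\<close> (when \<open>2 * k \<le> n\<close>),
  built from the \<open>k\<close> disjoint pairs \<open>{2 * i + 1, 2 * i + 2}\<close>.\<close>

definition pair_sign :: "nat \<Rightarrow> nat set \<Rightarrow> real" where
  "pair_sign k x = (\<Prod>i<k. of_bool (2 * i + 1 \<in> x) - of_bool (2 * i + 2 \<in> x))"

lemma pair_sign_eq_0: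
  assumes "i < k" and "2 * i + 1 \<notin> x" and "2 * i + 2 \<notin> x"
  shows "pair_sign k x = 0"
  unfolding pair_sign_def using assms by (intro prod_zero) auto

text \<open>Only the factor of pair \<open>i\<close> changes, and it changes sign.\<close>

lemma pair_sign_flip:
  assumes i: "i < k" and "2 * i + 1 \<in> y \<longleftrightarrow> 2 * i + 2 \<in> x" and "2 * i + 2 \<in> y \<longleftrightarrow> 2 * i + 1 \<in> x"
    and "\<And>j. j \<noteq> i \<Longrightarrow> 2 * j + 1 \<in> y \<longleftrightarrow> 2 * j + 1 \<in> x"
    and "\<And>j. j \<noteq> i \<Longrightarrow> 2 * j + 2 \<in> y \<longleftrightarrow> 2 * j + 2 \<in> x"
  shows "pair_sign k y = - pair_sign k x"
proof -
  let ?s = "\<lambda>x i. of_bool (2 * i + 1 \<in> x) - of_bool (2 * i + 2 \<in> x) :: real"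
  have split: "pair_sign k z = ?s z i * (\<Prod>j\<in>{..<k} - {i}. ?s z j)" for z
    unfolding pair_sign_def using i by (intro prod.remove) auto
  have "(\<Prod>j\<in>{..<k} - {i}. ?s y j) = (\<Prod>j\<in>{..<k} - {i}. ?s x j)"
    by (rule prod.cong) (use assms in auto)
  moreover have "?s y i = - ?s x i"
    using assms(2,3) by simp
  ultimately show ?thesis
    unfolding split by simp
qed

text \<open>Choosing one element of \<open>x\<close> from each of the \<open>k\<close> disjoint
  pairs already gives \<open>k\<close> elements, which exhaust \<open>x\<close>.\<close>

lemma transversal_of_pairs:
  fixes x :: "nat set"
  assumes "finite x" and "card x = k" and hit: "\<And>i. i < k \<Longrightarrow> 2 * i + 1 \<in> x \<or> 2 * i + 2 \<in> x"
  obtains g where "\<And>i. i < k \<Longrightarrow> g i = 2 * i + 1 \<or> g i = 2 * i + 2"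
    and "x = g ` {..<k}" and "inj_on g {..<k}"
proof -
  define g where "g i = (if 2 * i + 1 \<in> x then 2 * i + 1 else 2 * i + 2)" for i :: nat
  have g: "g i = 2 * i + 1 \<or> g i = 2 * i + 2" for i
    by (simp add: g_def)
  have inj: "inj_on g {..<k}"
  proof (rule inj_onI)
    fix i j assume "g i = g j"
    then show "i = j" using g[of i] g[of j] by presburger
  qed
  have "g ` {..<k} \<subseteq> x"
    using hit by (auto simp: g_def)
  then have "g ` {..<k} = x"
    using assms card_image[OF inj] by (intro card_subset_eq) auto
  then show ?thesis
    using that[of g] g inj by blast
qed

text \<open>If \<open>x\<close> misses pair \<open>i\<close>, only insertions from that pair can
  contribute, and the two cancel. Otherwise \<open>x\<close> has one element in each pair; removing
  one leaves its pair empty unless its partner is inserted, so each of the \<open>k\<close> removals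
  contributes \<open>- pair_sign k x\<close>.\<close>

lemma sum_neighbours_pair_sign:
  assumes x: "x \<in> pverts (johnson_graph n k)" and kn: "2 * k \<le> n"
  shows "(\<Sum>y\<in>neighbours (johnson_graph n k) x. pair_sign k y) = - real k * pair_sign k x"
proof (cases "\<exists>i<k. 2 * i + 1 \<notin> x \<and> 2 * i + 2 \<notin> x")
  case True
  then obtain i where i: "i < k" "2 * i + 1 \<notin> x" "2 * i + 2 \<notin> x" by blast
  have "(\<Sum>b\<in>{1..n} - x. pair_sign k (insert b (x - {a}))) = 0" for a
  proof -
    let ?f = "\<lambda>b. pair_sign k (insert b (x - {a}))"
    have "(\<Sum>b\<in>{1..n} - x. ?f b) = (\<Sum>b\<in>{2 * i + 1, 2 * i + 2}. ?f b)"
    proof (rule sum.mono_neutral_right)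
      show "\<forall>b\<in>{1..n} - x - {2 * i + 1, 2 * i + 2}. ?f b = 0"
        using i by (auto intro!: pair_sign_eq_0[of i])
    qed (use i kn in auto)
    also have "?f (2 * i + 2) = - ?f (2 * i + 1)"
      by (rule pair_sign_flip[OF i(1)]) (use i in auto)
    then have "(\<Sum>b\<in>{2 * i + 1, 2 * i + 2}. ?f b) = 0" by simp
    finally show ?thesis .
  qed
  then show ?thesis
    using pair_sign_eq_0[OF i] by (simp add: sum_neighbours_johnson_graph[OF x])
next
  case False
  have xs: "x \<subseteq> {1..n}" "card x = k" "finite x"
    using x by (auto simp: pverts_johnson_graph intro: finite_subset)
  obtain g where g: "\<And>i. i < k \<Longrightarrow> g i = 2 * i + 1 \<or> g i = 2 * i + 2"
    and xg: "x = g ` {..<k}" and inj: "inj_on g {..<k}"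
    using transversal_of_pairs[OF xs(3,2)] False by metis
  have "(\<Sum>b\<in>{1..n} - x. pair_sign k (insert b (x - {g i}))) = - pair_sign k x" if i: "i < k" for i
  proof -
    let ?f = "\<lambda>b. pair_sign k (insert b (x - {g i}))"
    obtain b where b: "b = 2 * i + 1 \<and> g i = 2 * i + 2 \<or> b = 2 * i + 2 \<and> g i = 2 * i + 1"
      using g[OF i] by blast
    have gi: "g i \<in> x"
      using i xg by blast
    \<comment> \<open>\<open>b\<close> is the partner of \<open>g i\<close>, and \<open>x\<close>
      meets each pair only once.\<close>
    have bx: "b \<notin> x"
    proof
      assume "b \<in> x"
      then obtain j where j: "j < k" "b = g j" using xg by auto
      then have "j = i" using b g[OF j(1)] by presburger
      then show False using j(2) b by presburger
    qed
    have "(\<Sum>b\<in>{1..n} - x. ?f b) = (\<Sum>b\<in>{b}. ?f b)"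
    proof (rule sum.mono_neutral_right)
      show "\<forall>c\<in>{1..n} - x - {b}. ?f c = 0"
      proof
        fix c assume c: "c \<in> {1..n} - x - {b}"
        show "?f c = 0"
          by (rule pair_sign_eq_0[OF i]) (use b bx gi c in auto)
      qed
      show "{b} \<subseteq> {1..n} - x"
        using b bx i kn by auto
    qed simp
    also have "\<dots> = - pair_sign k x"
      by (simp, rule pair_sign_flip[OF i]) (use b bx gi in auto)
    finally show ?thesis .
  qed
  then have "(\<Sum>a\<in>x. \<Sum>b\<in>{1..n} - x. pair_sign k (insert b (x - {a}))) = - real k * pair_sign k x"
    unfolding xg sum.reindex[OF inj] by simp
  then show ?thesis
    by (simp add: sum_neighbours_johnson_graph[OF x])
qed

lemma not_periodic_johnson_graph:
  assumes "1 \<le> k" and "k \<le> n - k" and "3 \<le> n - k"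
  shows "\<not> periodic (johnson_graph n k)"
proof
  assume per: "periodic (johnson_graph n k)"
  interpret pair_graph "johnson_graph n k"
    by (rule pair_graph_johnson_graph)
  let ?odd = "\<lambda>i. 2 * i + 1 :: nat"
  \<comment> \<open>The odd numbers pick the first element of every pair, so the eigenfunction is 1
    at \<open>u\<close>. Exchanging 1 for 4 empties the pair {1, 2}, so it is 0 at \<open>v\<close>;
    the hypotheses give 4 \<le> n.\<close>
  define u where "u = ?odd ` {..<k}"
  define v where "v = insert 4 (u - {1})"
  have u: "u \<in> pverts (johnson_graph n k)"
    using assms unfolding u_def
    by (auto simp: pverts_johnson_graph card_image inj_on_def)
  have "1 \<in> u"
    unfolding u_def using assms by (intro image_eqI[of _ _ 0]) auto
  moreover have "4 \<notin> u"
    unfolding u_def by (rule notI, elim imageE) presburger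
  ultimately have "v \<in> neighbours (johnson_graph n k) u"
    using bij_betwE[OF bij_betw_neighbours_johnson_graph[OF u]] assms
    unfolding v_def by (auto dest!: bspec[of _ _ "(1, 4)"])
  then have arc: "(u, v) \<in> parcs (johnson_graph n k)"
    by (simp add: neighbours_def)
  have "pair_sign k u = (\<Prod>i<k. 1)"
    unfolding pair_sign_def u_def by (rule prod.cong) (auto, presburger)
  then have fu: "pair_sign k u \<noteq> 0" by simp
  have "2 \<notin> u"
    unfolding u_def by auto
  then have fv: "pair_sign k v = 0"
    using assms unfolding v_def by (intro pair_sign_eq_0[of 0]) (auto simp: numeral_2_eq_2)
  \<comment> \<open>The fraction -2/(n - k) in lowest terms.\<close>
  define p r :: int where "p = (if even (n - k) then - 1 else - 2)"
    and "r = (if even (n - k) then int ((n - k) div 2) else int (n - k))"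
  have "2 * (- real k) / real (k * (n - k)) = - 2 / real (n - k)"
    using assms by (simp add: field_simps)
  also have "\<dots> = of_int p / of_int r"
    using assms by (auto simp: p_def r_def real_of_nat_div)
  finally have ratio: "2 * (- real k) / real (k * (n - k)) = of_int p / of_int r" .
  have "coprime p r"
    by (auto simp: p_def r_def)
  moreover have "r \<ge> 2"
  proof (cases "even (n - k)")
    case True
    then have "2 \<le> (n - k) div 2"
      using assms(3) by presburger
    then show ?thesis
      unfolding r_def if_P[OF True] by linarith
  next
    case False
    then show ?thesis
      unfolding r_def if_not_P[OF False] using assms(3) by linarith
  qed
  ultimately have "is_unit r"
    using assms
    by (intro is_unit_denominator_of_periodic[OF card_neighbours_johnson_graph
          sum_neighbours_pair_sign ratio _ _ arc fu fv per]) auto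
  then show False
    using \<open>r \<ge> 2\<close> by simp
qed

section \<open>The periodic cases\<close>

text \<open>Distinct singletons are disjoint, so \<open>J(n,1)\<close> is a complete graph.\<close>

lemma neighbours_johnson_graph_1:
  assumes "x \<in> pverts (johnson_graph n 1)"
  shows "neighbours (johnson_graph n 1) x = pverts (johnson_graph n 1) - {x}"
  using assms by (auto simp: neighbours_def johnson_graph_def card_1_singleton_iff)

text \<open>\<open>J(4,2)\<close> is the octahedron: of the possible intersection sizes 0, 1, 2, the
  extremes single out the complement and the set itself.\<close>

lemma neighbours_johnson_graph_4_2:
  assumes "x \<in> pverts (johnson_graph 4 2)"
  shows "neighbours (johnson_graph 4 2) x = pverts (johnson_graph 4 2) - {x, {1..4} - x}"
proof -
  have x: "x \<subseteq> {1..4}" "card x = 2" "finite x"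
    using assms by (auto simp: pverts_johnson_graph intro: finite_subset)
  have "card (x \<inter> y) + 1 = 2 \<longleftrightarrow> y \<noteq> x \<and> y \<noteq> {1..4} - x" if y: "y \<subseteq> {1..4}" "card y = 2" for y
  proof -
    have fin: "finite y" using y by (auto intro: finite_subset)
    have le: "card (x \<inter> y) \<le> 2"
      using card_mono[of x "x \<inter> y"] x by simp
    have "card (x \<inter> y) = 2 \<longleftrightarrow> y = x"
    proof
      assume "card (x \<inter> y) = 2"
      then have "x \<inter> y = x" "x \<inter> y = y"
        using card_subset_eq[of x "x \<inter> y"] card_subset_eq[of y "x \<inter> y"] x y fin by auto
      then show "y = x" by simp
    qed (use x in simp)
    moreover have "card (x \<inter> y) = 0 \<longleftrightarrow> y = {1..4} - x"
    proof
      assume "card (x \<inter> y) = 0"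
      then have "y \<subseteq> {1..4} - x"
        using x y by auto
      then show "y = {1..4} - x"
        using x y by (intro card_subset_eq) (auto simp: card_Diff_subset)
    qed auto
    ultimately show ?thesis using le by linarith
  qed
  then show ?thesis
    using x by (auto simp: neighbours_def johnson_graph_def)
qed

text \<open>The graph is a single edge, on which one step swaps the two arcs.\<close>

lemma periodic_johnson_graph_2_1: "periodic (johnson_graph 2 1)"
proof -
  let ?G = "johnson_graph 2 1"
  interpret pair_graph ?G
    by (rule pair_graph_johnson_graph)
  have reg: "card (neighbours ?G v) = 1" if "v \<in> pverts ?G" for v
    using card_neighbours_johnson_graph[OF that] by simp
  have single: "neighbours ?G u = {v}" if "(u, v) \<in> parcs ?G" for u v
    using reg[OF in_arcsD1[OF that]] that by (auto simp: neighbours_def card_1_singleton_iff)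
  have step: "grover_op ?G \<phi> (u, v) = \<phi> (v, u)" if "(u, v) \<in> parcs ?G" for \<phi> u v
    using grover_op_regular[OF reg that] single[OF that] by simp
  have "(grover_op ?G ^^ 2) \<phi> (u, v) = \<phi> (u, v)" if "(u, v) \<in> parcs ?G" for \<phi> u v
    using step[OF that] step[OF arcs_symmetric[OF that]] by (simp add: numeral_2_eq_2)
  then show ?thesis
    unfolding periodic_iff_grover_op[OF pair_finite_arcs] by (intro exI[of _ 2]) auto
qed

text \<open>In the triangle three consecutive in-sums at a vertex add up to \<open>s\<close>, so
  in-sums have period 3. Three double steps meet each residue modulo 3 once at \<open>u\<close> and
  once at \<open>v\<close>, and the two contributions \<open>s\<close> cancel.\<close>

lemma periodic_johnson_graph_3_1: "periodic (johnson_graph 3 1)"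
proof -
  let ?G = "johnson_graph 3 1"
  interpret pair_graph ?G
    by (rule pair_graph_johnson_graph)
  have reg: "card (neighbours ?G v) = 2" if "v \<in> pverts ?G" for v
    using card_neighbours_johnson_graph[OF that] by simp
  have "(grover_op ?G ^^ 6) \<phi> (u, v) = \<phi> (u, v)" if e: "(u, v) \<in> parcs ?G" for \<phi> u v
  proof -
    define P where "P m = (grover_op ?G ^^ m) \<phi> (u, v)" for m
    define A where "A m = in_sum ((grover_op ?G ^^ m) \<phi>)" for m
    define s where "s = (\<Sum>w\<in>pverts ?G. in_sum \<phi> w)"
    have A: "A (m + 2) w = s - A (m + 1) w - A m w" if w: "w \<in> pverts ?G" for m w
    proof -
      have "(\<Sum>y\<in>neighbours ?G w. A (m + 1) y) = s - A (m + 1) w"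
        using sum_in_sum_grover_op_pow[OF reg, of "m + 1" \<phi>] w pair_finite_verts
        unfolding neighbours_johnson_graph_1[OF w] by (simp add: sum_diff1 A_def s_def)
      then show ?thesis
        using in_sum_grover_op_pow_rec[OF reg _ w, of m \<phi>] by (simp add: A_def)
    qed
    have P: "P (m + 2) = P m + A (m + 1) u - A m v" for m
      using grover_op_pow_rec[OF reg _ e, of m \<phi>] by (simp add: P_def A_def)
    have u: "u \<in> pverts ?G" and v: "v \<in> pverts ?G"
      using in_arcsD1[OF e] in_arcsD2[OF e] .
    have "P 6 = P 0"
      using P[of 0] P[of 2] P[of 4] A[OF u, of 1] A[OF u, of 2] A[OF u, of 3]
        A[OF v, of 0] A[OF v, of 1] A[OF v, of 2] by (simp add: numeral_eq_Suc)
    then show ?thesis by (simp add: P_def)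
  qed
  then show ?thesis
    unfolding periodic_iff_grover_op[OF pair_finite_arcs] by (intro exI[of _ 6]) auto
qed

text \<open>In-sums have period 12, and over six double steps those at \<open>u\<close> and those at
  \<open>v\<close> each add up to \<open>s\<close>, so the increments cancel.\<close>

lemma periodic_johnson_graph_4_2: "periodic (johnson_graph 4 2)"
proof -
  let ?G = "johnson_graph 4 2" and ?c = "\<lambda>x. {1..4} - x :: nat set"
  interpret pair_graph ?G
    by (rule pair_graph_johnson_graph)
  have reg: "card (neighbours ?G v) = 4" if "v \<in> pverts ?G" for v
    using card_neighbours_johnson_graph[OF that] by simp
  have "(grover_op ?G ^^ 12) \<phi> (u, v) = \<phi> (u, v)" if e: "(u, v) \<in> parcs ?G" for \<phi> u v
  proof -
    define P where "P m = (grover_op ?G ^^ m) \<phi> (u, v)" for m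
    define A where "A m = in_sum ((grover_op ?G ^^ m) \<phi>)" for m
    define s where "s = (\<Sum>w\<in>pverts ?G. in_sum \<phi> w)"
    have compl: "?c w \<in> pverts ?G" "?c w \<noteq> w" "?c (?c w) = w" if "w \<in> pverts ?G" for w
    proof -
      have w: "w \<subseteq> {1..4}" "card w = 2"
        using that by (auto simp: pverts_johnson_graph)
      then show "?c w \<in> pverts ?G"
        by (auto simp: pverts_johnson_graph card_Diff_subset finite_subset[of w "{1..4}"])
      show "?c w \<noteq> w" using w by (metis Diff_disjoint card.empty inf.idem zero_neq_numeral)
      show "?c (?c w) = w" using w by auto
    qed
    have A: "A (m + 2) w = (s - A (m + 1) w - A (m + 1) (?c w)) / 2 - A m w"
      if w: "w \<in> pverts ?G" for m w
    proof -
      have "(\<Sum>y\<in>neighbours ?G w. A (m + 1) y) = s - A (m + 1) w - A (m + 1) (?c w)"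
        using sum_in_sum_grover_op_pow[OF reg, of "m + 1" \<phi>] w pair_finite_verts compl[OF w]
        by (simp add: neighbours_johnson_graph_4_2[OF w] sum_diff A_def s_def)
      then show ?thesis
        using in_sum_grover_op_pow_rec[OF reg _ w, of m \<phi>] by (simp add: A_def)
    qed
    \<comment> \<open>The part of \<open>A\<close> odd under complementation has period 4, the even part around its mean
      \<open>s / 6\<close> has period 3.\<close>
    have six_sum: "A m w + A (m + 2) w + A (m + 4) w + A (m + 6) w + A (m + 8) w + A (m + 10) w = s"
      if w: "w \<in> pverts ?G" for m w
    proof -
      define S D where "S m = A m w + A m (?c w)" and "D m = A m w - A m (?c w)" for m
      have S: "S (m + 2) = s - S (m + 1) - S m" and D: "D (m + 2) = - D m" for m
        using A[OF w, of m] A[OF compl(1)[OF w], of m] compl(3)[OF w]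
        by (simp_all add: S_def D_def field_simps)
      have S3: "S (m + 3) = S m" for m
        using S[of m] S[of "m + 1"] by (simp add: numeral_eq_Suc)
      \<comment> \<open>The six indices run twice through the residues modulo 3, and three
        consecutive values of \<open>S\<close> add up to \<open>s\<close>.\<close>
      have "S m + S (m + 2) + S (m + 4) + S (m + 6) + S (m + 8) + S (m + 10) = 2 * s"
        using S[of m] S3[of m] S3[of "m + 1"] S3[of "m + 2"] S3[of "m + 3"] S3[of "m + 4"]
          S3[of "m + 5"] S3[of "m + 7"] by (simp add: numeral_eq_Suc)
      moreover have "D m + D (m + 2) + D (m + 4) + D (m + 6) + D (m + 8) + D (m + 10) = 0"
        using D[of m] D[of "m + 2"] D[of "m + 4"] D[of "m + 6"] D[of "m + 8"]
        by (simp add: numeral_eq_Suc)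
      ultimately show ?thesis
        unfolding S_def D_def by linarith
    qed
    have P: "2 * P (m + 2) = 2 * P m + A (m + 1) u - A m v" for m
      using grover_op_pow_rec[OF reg _ e, of m \<phi>] by (simp add: P_def A_def)
    have u: "u \<in> pverts ?G" and v: "v \<in> pverts ?G"
      using in_arcsD1[OF e] in_arcsD2[OF e] .
    have "P 12 = P 0"
      using P[of 0] P[of 2] P[of 4] P[of 6] P[of 8] P[of 10]
        six_sum[OF u, of 1] six_sum[OF v, of 0] by (simp add: numeral_eq_Suc)
    then show ?thesis by (simp add: P_def)
  qed
  then show ?thesis
    unfolding periodic_iff_grover_op[OF pair_finite_arcs] by (intro exI[of _ 12]) auto
qed

section \<open>Classification of the parameters\<close>

lemma periodic_johnson_graph_iff:
  assumes "1 \<le> k" and "k \<le> n - 1"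
  shows "periodic (johnson_graph n k) \<longleftrightarrow> (n, k) \<in> {(2, 1), (3, 1), (3, 2), (4, 2)}"
proof
  assume per: "periodic (johnson_graph n k)"
  show "(n, k) \<in> {(2, 1), (3, 1), (3, 2), (4, 2)}"
  proof (cases "k \<le> n - k")
    case True
    then have "n - k \<le> 2"
      using not_periodic_johnson_graph[of k n] per assms by fastforce
    then have "k \<in> {1, 2}" "n - k \<in> {1, 2}"
      using assms True by auto
    then show ?thesis
      using True assms by auto
  next
    case False
    \<comment> \<open>Here n - k < k, so the complementary graph falls under the nonexistence result
      with \<open>k\<close> as the larger part; k \<le> 2 then leaves only (3, 2).\<close>
    have "periodic (johnson_graph n (n - k))"
      using assms
      by (intro periodic_digraph_iso[OF digraph_iso_johnson_graph_complement _ per]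
          pair_fin_digraph.pair_finite_arcs)
        (auto intro: pair_graph_johnson_graph pair_graph.axioms pair_digraph.axioms)
    then have "k \<le> 2"
      using not_periodic_johnson_graph[of "n - k" n] assms False by fastforce
    then show ?thesis
      using False assms by auto
  qed
next
  interpret J31: pair_graph "johnson_graph 3 1"
    by (rule pair_graph_johnson_graph)
  have "periodic (johnson_graph 3 (3 - 1))"
    by (rule periodic_digraph_iso[OF digraph_iso_johnson_graph_complement
        J31.pair_finite_arcs periodic_johnson_graph_3_1]) simp
  then have "periodic (johnson_graph 3 2)"
    by simp
  moreover assume "(n, k) \<in> {(2, 1), (3, 1), (3, 2), (4, 2)}"
  ultimately show "periodic (johnson_graph n k)"
    using periodic_johnson_graph_2_1 periodic_johnson_graph_3_1 periodic_johnson_graph_4_2 by auto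
qed

theorem theorem1p4:
  fixes n k :: nat
  assumes "1 \<le> k" and "k \<le> n - 1"
  shows "(periodic (johnson_graph n k) \<longleftrightarrow>
            digraph_iso (johnson_graph n k) (johnson_graph 2 1) \<or>
            digraph_iso (johnson_graph n k) (johnson_graph 3 1) \<or>
            digraph_iso (johnson_graph n k) (johnson_graph 4 2))
       \<and> (periodic (johnson_graph n k) \<longleftrightarrow>
            (n, k) \<in> {(2, 1), (3, 1), (3, 2), (4, 2)})"
proof -
  let ?iso = "\<lambda>n' k'. digraph_iso (johnson_graph n k) (johnson_graph n' k')"
  have iso_periodic: "periodic (johnson_graph n k)"
    if "?iso n' k'" "periodic (johnson_graph n' k')" for n' k'
  proof -
    interpret G: pair_graph "johnson_graph n k"
      by (rule pair_graph_johnson_graph)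
    interpret H: pair_graph "johnson_graph n' k'"
      by (rule pair_graph_johnson_graph)
    have "digraph_iso (johnson_graph n' k') (johnson_graph n k)"
      using digraph_iso_swap[OF _ that(1)] G.wf_digraph_axioms by simp
    then show ?thesis
      using H.pair_finite_arcs that(2) by (rule periodic_digraph_iso)
  qed
  \<comment> \<open>\<open>compl\<close> settles (3, 2); the other three pairs need reflexivity,
    obtained by complementing twice.\<close>
  have compl: "?iso n (n - k)"
    using assms by (intro digraph_iso_johnson_graph_complement) simp
  have refl: "?iso n k"
    using digraph_iso_trans[OF compl digraph_iso_johnson_graph_complement[of "n - k" n]] assms by simp
  have "?iso 2 1 \<or> ?iso 3 1 \<or> ?iso 4 2" if "(n, k) \<in> {(2, 1), (3, 1), (3, 2), (4, 2)}"
    using that compl refl by auto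
  then show ?thesis
    using periodic_johnson_graph_iff[OF assms] iso_periodic
      periodic_johnson_graph_2_1 periodic_johnson_graph_3_1 periodic_johnson_graph_4_2 by blast
qed

end
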